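(* Let $K$ be a real quadratic field with notation as below. Let $d$ be a positive integer, and let $r$ be the order of $\varepsilon+d\mathcal{O}_K$ in $(\mathcal{O}_K/d\mathcal{O}_K)^\times$. Write $d=2^{\ell_1}(2a+1)$ and $r=2^{\ell_2}(2b+1)$ with $\ell_1,\ell_2,a,b$ non-negative integers, let $\ell=\max\{\ell_1,\ell_2\}$, and let $j,m$ be positive integers with $2^\ell\mid j$ and $(2a+1)(2b+1)\mid(2m+1)$. If $d$ is even, assume in addition that $j$ is coprime to $3$ and that $3\mid(2m+1)$. Then: (1) if $d_1$ is even, then $d\mid d_{j,m}$; (2) if $d_1$ is odd, then $d\mid d_{j,m}$ if and only if $d$ is odd.
   Context: Let $K\subset\mathbb{R}$ be a real quadratic field of discriminant $\Delta_0$ with ring of integers $\mathcal{O}_K$, and let $\varepsilon$ be the smallest unit of $K$ of norm $+1$ that is greater than $1$. For positive integers $j$ set $f_j=(\varepsilon^j-\varepsilon^{-j})/\sqrt{\Delta_0}$. For positive integers $j,m$ set $r_{j,m}=f_{jm}/f_j$, $d_{j,m}=r_{j,m+1}+r_{j,m}$, and $d_1=d_{1,1}$ (which equals $\varepsilon+\varepsilon^{-1}+1$). *)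

theory Defs
  imports
    Complex_Main
    "HOL-Library.FuncSet"
    "HOL-Computational_Algebra.Polynomial"
    "HOL-Algebra.Embedded_Algebras"
    "HOL-Algebra.QuotRing"
    "HOL-Algebra.Multiplicative_Group"
begin

definition real_ring :: "real ring" where
  "real_ring = \<lparr>carrier = UNIV, mult = (*), one = 1, zero = 0, add = (+)\<rparr>"

definition real_quadratic_field :: "real set \<Rightarrow> bool" where
  "real_quadratic_field K \<longleftrightarrow>
     subfield K real_ring \<and> ring.dimension real_ring 2 \<rat> K"

definition int_ring :: "real set \<Rightarrow> real ring" where
  "int_ring K = real_ring\<lparr>carrier := {x \<in> K. algebraic_int x}\<rparr>"

text \<open>The nontrivial field automorphism of a quadratic field. Being \<^const>\<open>extensional\<close> makes it
  unique as a total function.\<close>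

definition quad_conj :: "real set \<Rightarrow> real \<Rightarrow> real" where
  "quad_conj K = (THE \<sigma>. \<sigma> \<in> ring_iso (real_ring\<lparr>carrier := K\<rparr>) (real_ring\<lparr>carrier := K\<rparr>) \<and>
                         \<sigma> \<in> extensional K \<and> (\<exists>x\<in>K. \<sigma> x \<noteq> x))"

definition quad_norm :: "real set \<Rightarrow> real \<Rightarrow> real" where
  "quad_norm K x = x * quad_conj K x"

definition integral_basis :: "real set \<Rightarrow> real \<Rightarrow> real \<Rightarrow> bool" where
  "integral_basis K v w \<longleftrightarrow>
     v \<in> carrier (int_ring K) \<and> w \<in> carrier (int_ring K) \<and>
     (\<forall>x \<in> carrier (int_ring K). \<exists>!(m, n). x = of_int m * v + of_int n * w)"

text \<open>The squared determinant of the matrix with rows \<open>(v, w)\<close> and \<open>(\<sigma> v, \<sigma> w)\<close>; its value does not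
  depend on the chosen integral basis.\<close>

definition has_discriminant :: "real set \<Rightarrow> int \<Rightarrow> bool" where
  "has_discriminant K \<Delta> \<longleftrightarrow>
     (\<exists>v w. integral_basis K v w \<and>
            of_int \<Delta> = (v * quad_conj K w - w * quad_conj K v)\<^sup>2)"

definition smallest_norm_one_unit :: "real set \<Rightarrow> real \<Rightarrow> bool" where
  "smallest_norm_one_unit K \<epsilon> \<longleftrightarrow>
     (let S = {u \<in> Units (int_ring K). quad_norm K u = 1 \<and> u > 1}
      in \<epsilon> \<in> S \<and> (\<forall>u\<in>S. \<epsilon> \<le> u))"

text \<open>The order of \<open>\<epsilon> + d\<O>\<^sub>K\<close> in the unit group of \<open>\<O>\<^sub>K / d\<O>\<^sub>K\<close>.\<close>

definition ord_mod :: "real set \<Rightarrow> nat \<Rightarrow> real \<Rightarrow> nat" where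
  "ord_mod K d \<epsilon> =
     (let R = int_ring K; I = PIdl\<^bsub>R\<^esub> (of_nat d)
      in group.ord (units_of (R Quot I)) (I +>\<^bsub>R\<^esub> \<epsilon>))"

definition f_seq :: "int \<Rightarrow> real \<Rightarrow> nat \<Rightarrow> real" where
  "f_seq \<Delta> \<epsilon> j = (\<epsilon> powi int j - \<epsilon> powi (- int j)) / sqrt (of_int \<Delta>)"

definition r_seq :: "int \<Rightarrow> real \<Rightarrow> nat \<Rightarrow> nat \<Rightarrow> real" where
  "r_seq \<Delta> \<epsilon> j m = f_seq \<Delta> \<epsilon> (j * m) / f_seq \<Delta> \<epsilon> j"

definition d_seq :: "int \<Rightarrow> real \<Rightarrow> nat \<Rightarrow> nat \<Rightarrow> real" where
  "d_seq \<Delta> \<epsilon> j m = r_seq \<Delta> \<epsilon> j (m + 1) + r_seq \<Delta> \<epsilon> j m"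

text \<open>Divisibility in \<open>\<int>\<close> and oddness for integers given as real numbers; on \<^typ>\<open>real\<close> itself,
  \<open>dvd\<close> is trivial.\<close>

definition int_dvd :: "nat \<Rightarrow> real \<Rightarrow> bool" where
  "int_dvd n x \<longleftrightarrow> (\<exists>k::int. x = of_nat n * of_int k)"

definition int_odd :: "real \<Rightarrow> bool" where
  "int_odd x \<longleftrightarrow> (\<exists>k::int. x = 2 * of_int k + 1)"

end

theory Submission
  imports Defs "Jordan_Normal_Form.Char_Poly"
begin

text \<open>
  With \<open>q = \<epsilon>\<^sup>j\<close> one has \<open>d\<^bsub>j,m\<^esub> = G q m\<close>, where \<open>G q m = q\<^sup>-\<^sup>m + \<dots> + q\<^sup>m\<close> is an
  integer because the traces of the powers of \<open>\<epsilon>\<close> are, and \<open>G q m = G q c * G q\<^bsup>2c+1\<^esup> s\<close> whenever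
  \<open>2m + 1 = (2c + 1) (2s + 1)\<close>.

  For the odd part of \<open>d\<close> take \<open>c = b\<close>: then \<open>q\<^bsup>2b+1\<^esup>\<close> is congruent to \<open>1\<close> modulo \<open>d\<close>, so the second
  factor is congruent to a unit times \<open>2s + 1\<close>, a multiple of \<open>2a + 1\<close>. The quotient of \<open>d\<^bsub>j,m\<^esub>\<close> by
  \<open>2a + 1\<close> is thus a rational algebraic integer.

  For the power of two take \<open>c = 1\<close>: the first factor is \<open>1 + t\<^sub>j\<close>, where \<open>t\<^sub>k\<close> denotes the trace of
  \<open>\<epsilon>\<^sup>k\<close>. If \<open>t\<^sub>1\<close> is odd, then \<open>t\<^sub>k\<close> is odd for \<open>k\<close> prime to \<open>3\<close>, and
  \<open>1 + t\<^bsub>2k\<^esub> = (t\<^sub>k + 1) (t\<^sub>k - 1)\<close> shows that \<open>2\<^bsup>n+1\<^esup>\<close> divides \<open>1 + t\<^sub>j\<close> if \<open>2\<^sup>n\<close> divides \<open>j\<close>.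
  If \<open>t\<^sub>1\<close> is even, all traces are even and \<open>d\<^bsub>j,m\<^esub>\<close> is odd.
\<close>

subsection \<open>Sums and products of algebraic integers\<close>

text \<open>The Z-module generated by \<open>S\<close>, with the generators indexing their own
  coefficients. It is meant for finite \<open>S\<close>: over an infinite set the sum defaults to
  0.\<close>

definition int_span :: "'a::field_char_0 set \<Rightarrow> 'a set" where
  "int_span S = range (\<lambda>c. \<Sum>v\<in>S. of_int (c v) * v)"

lemma int_spanI: "x = (\<Sum>v\<in>S. of_int (c v) * v) \<Longrightarrow> x \<in> int_span S"
  unfolding int_span_def by blast

lemma int_span_add: "x \<in> int_span S \<Longrightarrow> y \<in> int_span S \<Longrightarrow> x + y \<in> int_span S"
proof -
  assume "x \<in> int_span S" "y \<in> int_span S"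
  then obtain c e where "x = (\<Sum>v\<in>S. of_int (c v) * v)" "y = (\<Sum>v\<in>S. of_int (e v) * v)"
    unfolding int_span_def by auto
  then have "x + y = (\<Sum>v\<in>S. of_int (c v + e v) * v)"
    by (simp add: sum.distrib distrib_right)
  then show ?thesis by (rule int_spanI)
qed

lemma int_span_int_mult: "x \<in> int_span S \<Longrightarrow> of_int k * x \<in> int_span S"
proof -
  assume "x \<in> int_span S"
  then obtain c where "x = (\<Sum>v\<in>S. of_int (c v) * v)"
    unfolding int_span_def by auto
  then have "of_int k * x = (\<Sum>v\<in>S. of_int (k * c v) * v)"
    by (simp add: sum_distrib_left mult.assoc)
  then show ?thesis by (rule int_spanI)
qed

lemma int_span_zero: "0 \<in> int_span S"
  by (rule int_spanI[of _ "\<lambda>_. 0"]) simp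

lemma int_span_base:
  assumes "finite S" "x \<in> S" shows "x \<in> int_span S"
proof -
  have "x = (\<Sum>v\<in>S. of_int (if v = x then 1 else 0) * v)"
    using assms by (simp add: if_distrib[of of_int] if_distrib[of "\<lambda>u. u * _"] cong: if_cong)
  then show ?thesis by (rule int_spanI)
qed

lemma int_span_sum: "(\<And>i. i \<in> I \<Longrightarrow> f i \<in> int_span S) \<Longrightarrow> sum f I \<in> int_span S"
  by (induction I rule: infinite_finite_induct) (auto intro: int_span_zero int_span_add)

text \<open>Stability passes from the generators to the whole module. Products rely on this:
  \<open>y * s\<close> is only a combination of generators, and it still has to be multiplied by
  \<open>x\<close>.\<close>

lemma int_span_stable:
  assumes "\<And>s. s \<in> S \<Longrightarrow> z * s \<in> int_span S" and "x \<in> int_span S"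
  shows "z * x \<in> int_span S"
proof -
  from assms(2) obtain c where "x = (\<Sum>v\<in>S. of_int (c v) * v)"
    unfolding int_span_def by auto
  then have "z * x = (\<Sum>v\<in>S. of_int (c v) * (z * v))"
    by (simp add: sum_distrib_left mult_ac)
  then show ?thesis by (auto intro!: int_span_sum int_span_int_mult assms(1))
qed

text \<open>\<open>z\<close> is an eigenvalue of the integer matrix describing multiplication by \<open>z\<close> on \<open>S\<close>,
  hence a root of its monic characteristic polynomial.\<close>

lemma algebraic_int_if_stable_int_span:
  fixes z :: "'a::field_char_0"
  assumes S: "finite S" "1 \<in> S" and stable: "\<And>s. s \<in> S \<Longrightarrow> z * s \<in> int_span S"
  shows "algebraic_int z"
proof -
  obtain c where c: "\<And>s. s \<in> S \<Longrightarrow> z * s = (\<Sum>v\<in>S. of_int (c s v) * v)"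
    using bchoice[of S "\<lambda>s c. z * s = (\<Sum>v\<in>S. of_int (c v) * v)"] stable
    unfolding int_span_def by blast
  define n where "n = card S"
  obtain h where h: "bij_betw h {0..<n} S"
    using S(1) n_def ex_bij_betw_nat_finite by blast
  \<comment> \<open>Row \<open>i\<close> holds the coefficients of \<open>z * h i\<close>, so the
    vector \<open>w\<close> of generators satisfies the eigenvalue equation for
    \<open>z\<close>.\<close>
  define A where "A = mat n n (\<lambda>(i, k). c (h i) (h k))"
  have A: "A \<in> carrier_mat n n" by (simp add: A_def)
  define B :: "'a mat" where "B = map_mat of_int A"
  have B: "B \<in> carrier_mat n n" using A by (simp add: B_def)
  define w where "w = vec n h"
  have hS: "h i \<in> S" if "i < n" for i
    using h that by (auto simp: bij_betw_def)
  have "B *\<^sub>v w = z \<cdot>\<^sub>v w"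
  proof (rule eq_vecI)
    fix i assume "i < dim_vec (z \<cdot>\<^sub>v w)"
    then have i: "i < n" by (simp add: w_def)
    have "(B *\<^sub>v w) $ i = (\<Sum>k = 0..<n. of_int (c (h i) (h k)) * h k)"
      using i by (simp add: B_def A_def w_def scalar_prod_def)
    also have "\<dots> = (\<Sum>v\<in>S. of_int (c (h i) v) * v)"
      by (rule sum.reindex_bij_betw[OF h, of "\<lambda>v. of_int (c (h i) v) * v"])
    also have "\<dots> = z * h i" by (rule c[OF hS[OF i], symmetric])
    finally show "(B *\<^sub>v w) $ i = (z \<cdot>\<^sub>v w) $ i" using i by (simp add: w_def)
  qed (use B in \<open>auto simp: w_def\<close>)
  \<comment> \<open>An eigenvector must be nonzero; the generator 1 supplies a nonzero
    entry.\<close>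
  moreover obtain i where "i < n" "h i = 1"
    using h S(2) by (auto simp: bij_betw_def)
  then have "w $ i \<noteq> 0\<^sub>v n $ i" by (simp add: w_def)
  then have "w \<noteq> 0\<^sub>v n" by metis
  ultimately have "eigenvalue B z"
    unfolding eigenvalue_def eigenvector_def using B
    by (intro exI[of _ w]) (auto simp: w_def)
  then have "poly (char_poly B) z = 0"
    using eigenvalue_root_char_poly[OF B] by simp
  moreover have "char_poly B = map_poly of_int (char_poly A)"
    unfolding B_def by (rule of_int_hom.char_poly_hom[OF A])
  ultimately show ?thesis
    unfolding algebraic_int_altdef_ipoly using degree_monic_char_poly[OF A] by auto
qed

lemma algebraic_int_power_reduce:
  fixes x :: "'a::field_char_0"
  assumes "algebraic_int x"
  obtains n c where "n > 0" "x ^ n = (\<Sum>i<n. of_int (c i) * x ^ i)"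
proof -
  obtain p where p: "poly (map_poly of_int p) x = 0" "lead_coeff p = 1"
    using assms unfolding algebraic_int_altdef_ipoly by blast
  let ?n = "degree p"
  have "(\<Sum>i\<le>?n. of_int (Polynomial.coeff p i) * x ^ i) = 0"
    using p(1) by (simp add: poly_altdef)
  then have "x ^ ?n + (\<Sum>i<?n. of_int (Polynomial.coeff p i) * x ^ i) = 0"
    unfolding lessThan_Suc_atMost[symmetric] sum.lessThan_Suc using p(2)
    by (simp add: add.commute)
  then have eq: "x ^ ?n = (\<Sum>i<?n. of_int (- Polynomial.coeff p i) * x ^ i)"
    by (simp add: sum_negf eq_neg_iff_add_eq_0)
  \<comment> \<open>In degree 0 the relation would read \<open>1 = 0\<close>.\<close>
  have "?n > 0" using eq by (metis gr0I lessThan_0 power_0 sum.empty zero_neq_one)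
  then show ?thesis using eq by (rule that)
qed

text \<open>Take the monomials \<open>x ^ i * y ^ k\<close> with exponents below the degrees of
  monic relations for \<open>x\<close> and \<open>y\<close>; an exponent that reaches the degree is
  reduced by the relation.\<close>

lemma algebraic_int_common_span:
  fixes x y :: "'a::field_char_0"
  assumes "algebraic_int x" "algebraic_int y"
  obtains S where "finite S" "1 \<in> S" "\<And>s. s \<in> S \<Longrightarrow> x * s \<in> int_span S"
    "\<And>s. s \<in> S \<Longrightarrow> y * s \<in> int_span S"
proof -
  obtain n c where n: "n > 0" "x ^ n = (\<Sum>i<n. of_int (c i) * x ^ i)"
    using algebraic_int_power_reduce[OF assms(1)] .
  obtain m e where m: "m > 0" "y ^ m = (\<Sum>i<m. of_int (e i) * y ^ i)"
    using algebraic_int_power_reduce[OF assms(2)] .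
  define S where "S = (\<lambda>(i, k). x ^ i * y ^ k) ` ({..<n} \<times> {..<m})"
  have fin: "finite S" by (simp add: S_def)
  have mem: "x ^ i * y ^ k \<in> int_span S" if "i < n" "k < m" for i k
    using that by (intro int_span_base fin) (auto simp: S_def)
  have "x * s \<in> int_span S" if s: "s \<in> S" for s
  proof -
    obtain i k where ik: "i < n" "k < m" "s = x ^ i * y ^ k" using s by (auto simp: S_def)
    show ?thesis
    proof (cases "Suc i < n")
      case True
      then show ?thesis using mem[of "Suc i" k] ik by (simp add: mult_ac)
    next
      case False
      then have "Suc i = n" using ik by simp
      then have "x * s = x ^ n * y ^ k" using ik by auto
      also have "\<dots> = (\<Sum>i<n. of_int (c i) * (x ^ i * y ^ k))"
        by (simp only: n(2) sum_distrib_right mult.assoc)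
      finally show ?thesis using ik by (auto intro!: int_span_sum int_span_int_mult mem)
    qed
  qed
  moreover have "y * s \<in> int_span S" if s: "s \<in> S" for s
  proof -
    obtain i k where ik: "i < n" "k < m" "s = x ^ i * y ^ k" using s by (auto simp: S_def)
    show ?thesis
    proof (cases "Suc k < m")
      case True
      then show ?thesis using mem[of i "Suc k"] ik by (simp add: mult_ac)
    next
      case False
      then have "Suc k = m" using ik by simp
      then have "y * s = x ^ i * y ^ m" using ik by auto
      also have "\<dots> = (\<Sum>k<m. of_int (e k) * (x ^ i * y ^ k))"
        unfolding m(2) by (simp add: sum_distrib_left mult_ac)
      finally show ?thesis using ik by (auto intro!: int_span_sum int_span_int_mult mem)
    qed
  qed
  moreover have "1 \<in> S" unfolding S_def using n m by (auto intro!: image_eqI[of _ _ "(0, 0)"])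
  ultimately show ?thesis using that fin by blast
qed

lemma algebraic_int_add:
  fixes x y :: "'a::field_char_0"
  assumes "algebraic_int x" "algebraic_int y"
  shows "algebraic_int (x + y)"
proof -
  obtain S where "finite S" "1 \<in> S" "\<And>s. s \<in> S \<Longrightarrow> x * s \<in> int_span S"
    "\<And>s. s \<in> S \<Longrightarrow> y * s \<in> int_span S"
    using algebraic_int_common_span[OF assms] by blast
  then show ?thesis
    by (intro algebraic_int_if_stable_int_span[of S]) (auto simp: distrib_right intro: int_span_add)
qed

lemma algebraic_int_mult:
  fixes x y :: "'a::field_char_0"
  assumes "algebraic_int x" "algebraic_int y"
  shows "algebraic_int (x * y)"
proof -
  obtain S where "finite S" "1 \<in> S" "\<And>s. s \<in> S \<Longrightarrow> x * s \<in> int_span S"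
    "\<And>s. s \<in> S \<Longrightarrow> y * s \<in> int_span S"
    using algebraic_int_common_span[OF assms] by blast
  then show ?thesis
    by (intro algebraic_int_if_stable_int_span[of S]) (auto simp: mult.assoc intro: int_span_stable)
qed

lemma algebraic_int_power:
  fixes x :: "'a::field_char_0"
  shows "algebraic_int x \<Longrightarrow> algebraic_int (x ^ n)"
  by (induction n) (auto intro: algebraic_int_mult)

lemma algebraic_int_sum:
  fixes f :: "'b \<Rightarrow> 'a::field_char_0"
  shows "(\<And>i. i \<in> I \<Longrightarrow> algebraic_int (f i)) \<Longrightarrow> algebraic_int (sum f I)"
  by (induction I rule: infinite_finite_induct) (auto intro: algebraic_int_add)

subsection \<open>The ring of integers and the order of a unit modulo \<open>d\<close>\<close>

lemma real_ring_simps [simp]: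
  "carrier real_ring = UNIV" "mult real_ring = (*)" "one real_ring = 1"
  "zero real_ring = 0" "add real_ring = (+)"
  by (simp_all add: real_ring_def)

lemma cring_real_ring: "cring real_ring"
  by unfold_locales
    (auto simp: algebra_simps Units_def intro: exI[of _ "- x" for x] add.left_inverse)

lemma ring_real_ring: "ring real_ring"
  using cring_real_ring by (rule cring.axioms)

lemma a_inv_real_ring [simp]: "\<ominus>\<^bsub>real_ring\<^esub> x = - x"
proof -
  interpret cring real_ring by (rule cring_real_ring)
  show ?thesis by (rule minus_equality) auto
qed

lemma subfield_real_closed:
  assumes "subfield K real_ring"
  shows "0 \<in> K" "1 \<in> K" "x \<in> K \<Longrightarrow> y \<in> K \<Longrightarrow> x + y \<in> K" "x \<in> K \<Longrightarrow> y \<in> K \<Longrightarrow> x * y \<in> K"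
    "x \<in> K \<Longrightarrow> - x \<in> K"
  using subcringE[OF subdomain.axioms(1)[OF subfield.axioms(1)[OF assms]]] by auto

lemma subfield_rats:
  assumes "subfield K real_ring" shows "\<rat> \<subseteq> K"
proof -
  note K = subfield_real_closed[OF assms]
  have nat: "of_nat n \<in> K" for n by (induction n) (auto intro: K)
  have int: "of_int n \<in> K" for n
    by (cases n) (use nat[of "nat n"] nat K in \<open>auto simp del: of_nat_Suc\<close>)
  have inv: "inverse x \<in> K" if "x \<in> K" "x \<noteq> 0" for x
  proof -
    have "x \<in> Units (real_ring\<lparr>carrier := K\<rparr>)"
      using that subfield.subfield_Units[OF assms] by simp
    then obtain y where "y \<in> K" "x * y = 1" unfolding Units_def by auto
    then show ?thesis using inverse_unique by metis
  qed
  show ?thesis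
  proof
    fix x :: real assume "x \<in> \<rat>"
    then obtain a b where "b \<noteq> 0" "x = of_int a / of_int b"
      by (metis Rats_cases' less_numeral_extra(3))
    then show "x \<in> K"
      using K(4)[OF int[of a] inv[OF int[of b]]] by (simp add: divide_inverse)
  qed
qed

lemma int_ring_simps [simp]:
  "carrier (int_ring K) = {x \<in> K. algebraic_int x}" "mult (int_ring K) = (*)"
  "one (int_ring K) = 1" "zero (int_ring K) = 0" "add (int_ring K) = (+)"
  by (simp_all add: int_ring_def)

lemma cring_int_ring:
  assumes "subfield K real_ring"
  shows "cring (int_ring K)"
proof -
  interpret cring real_ring by (rule cring_real_ring)
  note K = subfield_real_closed[OF assms]
  have "subring {x \<in> K. algebraic_int x} real_ring"
    by (rule subringI) (auto intro: K algebraic_int_add algebraic_int_mult)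
  then have "subcring {x \<in> K. algebraic_int x} real_ring" by (rule subcringI')
  then show ?thesis
    unfolding int_ring_def by (subst (asm) subcring_iff) auto
qed

lemma nat_pow_int_ring [simp]: "x [^]\<^bsub>int_ring K\<^esub> (n::nat) = x ^ n"
  by (induction n) (auto simp: nat_pow_def mult.commute)

text \<open>Turns the order in the quotient ring into a congruence between real numbers: the power
  of the coset is 1, so the power of \<open>u\<close> minus 1 lies in the principal ideal of
  \<open>d\<close>.\<close>

lemma unit_pow_ord_mod:
  assumes K: "subfield K real_ring" and u: "u \<in> Units (int_ring K)"
  obtains x where "algebraic_int x" "u ^ ord_mod K d u = 1 + of_nat d * x"
proof -
  let ?R = "int_ring K"
  interpret R: cring ?R using cring_int_ring[OF K] .
  define I where "I = PIdl\<^bsub>?R\<^esub> (of_nat d)"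
  have "of_nat d \<in> K" using subfield_rats[OF K] by auto
  then have d: "of_nat d \<in> carrier ?R" by (auto intro: int_imp_algebraic_int)
  interpret I: ideal I ?R unfolding I_def using d by (rule R.cgenideal_ideal)
  interpret h: ring_hom_ring ?R "?R Quot I" "(+>\<^bsub>?R\<^esub>) I" by (rule I.rcos_ring_hom_ring)
  interpret U: group "units_of (?R Quot I)" by (rule h.S.units_group)
  have uc: "u \<in> carrier ?R" using u R.Units_closed by blast
  obtain v where v: "v \<in> carrier ?R" "v \<otimes>\<^bsub>?R\<^esub> u = \<one>\<^bsub>?R\<^esub>" "u \<otimes>\<^bsub>?R\<^esub> v = \<one>\<^bsub>?R\<^esub>"
    using u unfolding Units_def by blast
  have cu: "I +>\<^bsub>?R\<^esub> u \<in> Units (?R Quot I)"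
    unfolding Units_def
    using h.hom_closed[OF uc] h.hom_closed[OF v(1)] h.hom_mult[OF uc v(1)] h.hom_mult[OF v(1) uc]
      v(2,3) h.hom_one by (intro CollectI conjI bexI[of _ "I +>\<^bsub>?R\<^esub> v"]) metis+
  let ?n = "ord_mod K d u"
  have n: "?n = U.ord (I +>\<^bsub>?R\<^esub> u)" unfolding ord_mod_def I_def Let_def ..
  \<comment> \<open>For an element of infinite order \<open>ord\<close> is 0, so no finiteness of
    the quotient ring has to be shown.\<close>
  have "(I +>\<^bsub>?R\<^esub> u) [^]\<^bsub>units_of (?R Quot I)\<^esub> ?n = \<one>\<^bsub>units_of (?R Quot I)\<^esub>"
    unfolding n by (rule U.pow_ord_eq_1) (use cu in \<open>simp add: units_of_carrier\<close>)
  then have "(I +>\<^bsub>?R\<^esub> u) [^]\<^bsub>?R Quot I\<^esub> ?n = \<one>\<^bsub>?R Quot I\<^esub>"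
    using h.S.units_of_pow[OF cu] by (simp add: units_of_one)
  then have "I +>\<^bsub>?R\<^esub> (u [^]\<^bsub>?R\<^esub> ?n) = I +>\<^bsub>?R\<^esub> \<one>\<^bsub>?R\<^esub>"
    using h.hom_nat_pow[OF uc] h.hom_one by metis
  then have "u [^]\<^bsub>?R\<^esub> ?n \<ominus>\<^bsub>?R\<^esub> \<one>\<^bsub>?R\<^esub> \<in> I"
    using R.quotient_eq_iff_same_a_r_cos[OF I.ideal_axioms R.nat_pow_closed[OF uc] R.one_closed]
    by blast
  then obtain x where x: "x \<in> carrier ?R" "u [^]\<^bsub>?R\<^esub> ?n \<ominus>\<^bsub>?R\<^esub> \<one>\<^bsub>?R\<^esub> = x * of_nat d"
    unfolding I_def cgenideal_def by auto
  have "u [^]\<^bsub>?R\<^esub> ?n = (u [^]\<^bsub>?R\<^esub> ?n \<ominus>\<^bsub>?R\<^esub> \<one>\<^bsub>?R\<^esub>) \<oplus>\<^bsub>?R\<^esub> \<one>\<^bsub>?R\<^esub>"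
    using R.nat_pow_closed[OF uc] R.one_closed by algebra
  then have "u ^ ?n = x * of_nat d + 1" using x(2) by simp
  then have "u ^ ?n = 1 + of_nat d * x" by simp
  moreover have "algebraic_int x" using x(1) by simp
  ultimately show ?thesis by (rule that[rotated])
qed

subsection \<open>Conjugation in a real quadratic field\<close>

text \<open>The inductive \<open>dimension\<close> is peeled twice, giving \<open>v\<close> and then
  \<open>w\<close>, and ends at the zero space.\<close>

lemma real_quadratic_field_basis:
  assumes "real_quadratic_field K"
  obtains v w where "w \<noteq> 0" "\<forall>a\<in>\<rat>. v \<noteq> a * w"
    "\<forall>x. x \<in> K \<longleftrightarrow> (\<exists>a\<in>\<rat>. \<exists>b\<in>\<rat>. x = a * v + b * w)"
proof -
  interpret ring real_ring by (rule ring_real_ring)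
  have "dimension (Suc (Suc 0)) \<rat> K"
    using assms by (simp add: real_quadratic_field_def numeral_2_eq_2)
  then obtain v E where v: "v \<notin> E" "K = line_extension \<rat> v E" and E: "dimension (Suc 0) \<rat> E"
    by (cases rule: dimension.cases) auto
  from E obtain w F where w: "w \<notin> F" "E = line_extension \<rat> w F" and F: "dimension 0 \<rat> F"
    by (cases rule: dimension.cases) auto
  from F have "F = {0}" by (cases rule: dimension.cases) auto
  then have w0: "w \<noteq> 0" and E': "E = (\<lambda>a. a * w) ` \<rat>"
    using w by (auto simp: line_extension_mem_iff)
  show ?thesis
  proof (rule that[OF w0])
    show "\<forall>a\<in>\<rat>. v \<noteq> a * w" using v(1) E' by blast
    show "\<forall>x. x \<in> K \<longleftrightarrow> (\<exists>a\<in>\<rat>. \<exists>b\<in>\<rat>. x = a * v + b * w)"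
      unfolding v(2) line_extension_mem_iff E' by simp
  qed
qed

lemma real_quadratic_field_irrational:
  assumes "real_quadratic_field K"
  obtains x where "x \<in> K" "x \<notin> \<rat>"
proof -
  obtain v w where vw: "w \<noteq> 0" "\<forall>a\<in>\<rat>. v \<noteq> a * w"
    "\<forall>x. x \<in> K \<longleftrightarrow> (\<exists>a\<in>\<rat>. \<exists>b\<in>\<rat>. x = a * v + b * w)"
    by (rule real_quadratic_field_basis[OF assms])
  have "v \<in> K" unfolding vw(3)[rule_format] by (rule bexI[of _ 1], rule bexI[of _ 0]) auto
  moreover have "w \<in> K" unfolding vw(3)[rule_format] by (rule bexI[of _ 0], rule bexI[of _ 1]) auto
  moreover have "v / w \<notin> \<rat>" using vw(1) vw(2)[rule_format, of "v / w"] by auto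
  then have "v \<notin> \<rat> \<or> w \<notin> \<rat>" using Rats_divide by blast
  ultimately show ?thesis using that by blast
qed

text \<open>Cramer's rule: \<open>1\<close> and \<open>\<alpha>\<close> are written in a basis
  \<open>v\<close>, \<open>w\<close>, and this change of basis is inverted with its determinant
  \<open>\<delta>\<close>.\<close>

lemma real_quadratic_field_coordinates:
  assumes "real_quadratic_field K" "\<alpha> \<in> K" "\<alpha> \<notin> \<rat>" "x \<in> K"
  obtains a b where "a \<in> \<rat>" "b \<in> \<rat>" "x = a + b * \<alpha>"
proof -
  obtain v w where vw: "\<forall>x. x \<in> K \<longleftrightarrow> (\<exists>a\<in>\<rat>. \<exists>b\<in>\<rat>. x = a * v + b * w)"
    by (rule real_quadratic_field_basis[OF assms(1)])
  have "1 \<in> K" using assms(1) subfield_real_closed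
    unfolding real_quadratic_field_def by blast
  then obtain a b where ab: "a \<in> \<rat>" "b \<in> \<rat>" "1 = a * v + b * w" using vw by blast
  obtain c e where ce: "c \<in> \<rat>" "e \<in> \<rat>" "\<alpha> = c * v + e * w" using vw assms(2) by blast
  obtain p q where pq: "p \<in> \<rat>" "q \<in> \<rat>" "x = p * v + q * w" using vw assms(4) by blast
  define \<delta> where "\<delta> = a * e - b * c"
  have dw: "\<delta> * w = a * \<alpha> - c"
  proof -
    have "a * \<alpha> - c * 1 = \<delta> * w" unfolding ce(3) ab(3) \<delta>_def by (simp add: algebra_simps)
    then show ?thesis by simp
  qed
  have dv: "\<delta> * v = e - b * \<alpha>"
  proof -
    have "e * 1 - b * \<alpha> = \<delta> * v" unfolding ce(3) ab(3) \<delta>_def by (simp add: algebra_simps)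
    then show ?thesis by simp
  qed
  \<comment> \<open>If the determinant vanished, \<open>\<alpha>\<close> would be a quotient of
    rationals, since \<open>a\<close> and \<open>b\<close> are not both 0.\<close>
  have d: "\<delta> \<noteq> 0"
  proof
    assume "\<delta> = 0"
    then have *: "a * \<alpha> = c" "b * \<alpha> = e" using dw dv by auto
    have "a \<noteq> 0 \<or> b \<noteq> 0" using ab(3) by auto
    then have "\<alpha> = c / a \<or> \<alpha> = e / b" using * by (auto simp: field_simps)
    then show False using assms(3) ab ce Rats_divide by blast
  qed
  have "\<delta> * x = p * (\<delta> * v) + q * (\<delta> * w)" unfolding pq(3) by (simp add: algebra_simps)
  also have "\<dots> = (p * e - q * c) + (q * a - p * b) * \<alpha>"
    unfolding dw dv by (simp add: algebra_simps)
  finally have "x = ((p * e - q * c) + (q * a - p * b) * \<alpha>) / \<delta>"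
    using d by (simp only: eq_divide_eq mult.commute[of x]) simp
  then have "x = (p * e - q * c) / \<delta> + (q * a - p * b) / \<delta> * \<alpha>"
    by (simp add: add_divide_distrib)
  moreover have "\<delta> \<in> \<rat>" using ab ce by (simp add: \<delta>_def)
  ultimately show ?thesis using that ab ce pq by (metis Rats_diff Rats_divide Rats_mult)
qed

section \<open>Existence and uniqueness of the nontrivial automorphism\<close>

lemma subfield_hom_rat:
  fixes \<tau> :: "real \<Rightarrow> real"
  assumes K: "subfield K real_ring"
    and hom: "\<tau> \<in> Ring.ring_hom (real_ring\<lparr>carrier := K\<rparr>) (real_ring\<lparr>carrier := L\<rparr>)"
    and x: "x \<in> \<rat>"
  shows "\<tau> x = x"
proof -
  note closed = subfield_real_closed[OF K] and QK = subfield_rats[OF K]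
  have add: "\<tau> (a + b) = \<tau> a + \<tau> b" if "a \<in> K" "b \<in> K" for a b
    using ring_hom_add[OF hom, of a b] that by simp
  have mult: "\<tau> (a * b) = \<tau> a * \<tau> b" if "a \<in> K" "b \<in> K" for a b
    using ring_hom_mult[OF hom, of a b] that by simp
  have one: "\<tau> 1 = 1" using ring_hom_one[OF hom] by simp
  have zero: "\<tau> 0 = 0" using add[of 0 0] closed(1) by simp
  have nat: "\<tau> (of_nat n) = of_nat n" for n
    using QK one zero closed by (induction n) (auto simp: add subset_iff)
  have int: "\<tau> (of_int n) = of_int n" for n
  proof (cases n rule: int_cases2)
    case (nonneg k)
    then show ?thesis using nat by simp
  next
    case (nonpos k)
    have "\<tau> (- of_nat k + of_nat k) = \<tau> (- of_nat k) + \<tau> (of_nat k)"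
      using QK by (intro add) auto
    then show ?thesis using nonpos nat zero by simp
  qed
  obtain a b where ab: "b \<noteq> 0" "x = of_int a / of_int b"
    using x by (metis Rats_cases' less_numeral_extra(3))
  have xb: "x * of_int b = of_int a" using ab by simp
  have "\<tau> (x * of_int b) = \<tau> x * \<tau> (of_int b)" using x QK by (intro mult) auto
  then have "\<tau> x * of_int b = x * of_int b" by (simp only: xb int)
  then show ?thesis using ab(1) by simp
qed

text \<open>Completing the square in \<open>\<alpha> * \<alpha> = p + q * \<alpha>\<close> yields
  \<open>\<alpha> - q / 2\<close>.\<close>

lemma real_quadratic_field_sqrt_generator:
  assumes K: "real_quadratic_field K"
  obtains \<beta> where "\<beta> \<in> K" "\<beta> \<notin> \<rat>" "\<beta> * \<beta> \<in> \<rat>"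
proof -
  have sub: "subfield K real_ring" using K by (simp add: real_quadratic_field_def)
  note closed = subfield_real_closed[OF sub] and QK = subfield_rats[OF sub]
  obtain \<alpha> where \<alpha>: "\<alpha> \<in> K" "\<alpha> \<notin> \<rat>" using real_quadratic_field_irrational[OF K] by blast
  obtain p q where pq: "p \<in> \<rat>" "q \<in> \<rat>" "\<alpha> * \<alpha> = p + q * \<alpha>"
    using real_quadratic_field_coordinates[OF K \<alpha> closed(4)[OF \<alpha>(1) \<alpha>(1)]] .
  have q2: "- (q / 2) \<in> \<rat>" using pq by simp
  show ?thesis
  proof (rule that[of "\<alpha> + - (q / 2)"])
    show "\<alpha> + - (q / 2) \<in> K" using closed(3)[OF \<alpha>(1)] QK q2 by blast
    show "\<alpha> + - (q / 2) \<notin> \<rat>"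
    proof
      assume "\<alpha> + - (q / 2) \<in> \<rat>"
      from Rats_diff[OF this q2] have "\<alpha> + - (q / 2) - - (q / 2) \<in> \<rat>" .
      then show False using \<alpha> by simp
    qed
    have "(\<alpha> + - (q / 2)) * (\<alpha> + - (q / 2)) = \<alpha> * \<alpha> - q * \<alpha> + q * q / 4"
      by (simp add: field_simps)
    also have "\<dots> = p + q * q / 4" unfolding pq(3) by simp
    finally show "(\<alpha> + - (q / 2)) * (\<alpha> + - (q / 2)) \<in> \<rat>" using pq by simp
  qed
qed

text \<open>The witness sends \<open>a + b * \<beta>\<close> to \<open>a - b * \<beta>\<close>. It
  is multiplicative because \<open>\<beta> * \<beta>\<close> is rational, and bijective because it
  is its own inverse.\<close>

lemma quad_conj_exists:
  assumes K: "real_quadratic_field K"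
  shows "\<exists>\<sigma>. \<sigma> \<in> ring_iso (real_ring\<lparr>carrier := K\<rparr>) (real_ring\<lparr>carrier := K\<rparr>) \<and>
             \<sigma> \<in> extensional K \<and> (\<exists>x\<in>K. \<sigma> x \<noteq> x)"
proof -
  have sub: "subfield K real_ring" using K by (simp add: real_quadratic_field_def)
  note closed = subfield_real_closed[OF sub] and QK = subfield_rats[OF sub]
  obtain \<beta> where \<beta>: "\<beta> \<in> K" "\<beta> \<notin> \<rat>" "\<beta> * \<beta> \<in> \<rat>"
    using real_quadratic_field_sqrt_generator[OF K] .
  note coord = real_quadratic_field_coordinates[OF K \<beta>(1,2)]
  have unique: "a = c \<and> b = e"
    if "a + b * \<beta> = c + e * \<beta>" "a \<in> \<rat>" "b \<in> \<rat>" "c \<in> \<rat>" "e \<in> \<rat>" for a b c e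
  proof -
    have eq: "(b - e) * \<beta> = c - a" using that(1) by (simp add: algebra_simps)
    have "b = e"
    proof (rule ccontr)
      assume "b \<noteq> e"
      then have "\<beta> = (c - a) / (b - e)" using eq by (simp add: field_simps)
      then show False using \<beta>(2) that by (metis Rats_diff Rats_divide)
    qed
    then show ?thesis using eq by simp
  qed
  have mem: "a + b * \<beta> \<in> K" if "a \<in> \<rat>" "b \<in> \<rat>" for a b
    using that QK \<beta>(1) closed(3,4) by blast
  \<comment> \<open>The description is well defined by uniqueness of coordinates;
    \<open>restrict\<close> makes the map extensional.\<close>
  define \<sigma> where "\<sigma> = restrict
    (\<lambda>x. THE y. \<exists>a\<in>\<rat>. \<exists>b\<in>\<rat>. x = a + b * \<beta> \<and> y = a - b * \<beta>) K"
  have \<sigma>: "\<sigma> (a + b * \<beta>) = a - b * \<beta>" if ab: "a \<in> \<rat>" "b \<in> \<rat>" for a b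
  proof -
    have "(THE y. \<exists>c\<in>\<rat>. \<exists>e\<in>\<rat>. a + b * \<beta> = c + e * \<beta> \<and> y = c - e * \<beta>) = a - b * \<beta>"
      by (rule the_equality) (use ab unique in blast)+
    then show ?thesis using mem[OF ab] by (simp add: \<sigma>_def)
  qed
  have \<sigma>K: "\<sigma> x \<in> K" if x: "x \<in> K" for x
  proof -
    obtain a b where ab: "a \<in> \<rat>" "b \<in> \<rat>" "x = a + b * \<beta>" using coord[OF x] .
    then show ?thesis using \<sigma>[OF ab(1,2)] mem[of a "- b"] by simp
  qed
  have \<sigma>\<sigma>: "\<sigma> (\<sigma> x) = x" if x: "x \<in> K" for x
  proof -
    obtain a b where ab: "a \<in> \<rat>" "b \<in> \<rat>" "x = a + b * \<beta>" using coord[OF x] .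
    then show ?thesis using \<sigma>[OF ab(1,2)] \<sigma>[of a "- b"] by simp
  qed
  have "\<sigma> \<in> Ring.ring_hom (real_ring\<lparr>carrier := K\<rparr>) (real_ring\<lparr>carrier := K\<rparr>)"
  proof (rule ring_hom_memI, simp_all add: \<sigma>K)
    fix x y assume xy: "x \<in> K" "y \<in> K"
    obtain a b where x: "a \<in> \<rat>" "b \<in> \<rat>" "x = a + b * \<beta>" using coord[OF xy(1)] .
    obtain c e where y: "c \<in> \<rat>" "e \<in> \<rat>" "y = c + e * \<beta>" using coord[OF xy(2)] .
    have "x + y = (a + c) + (b + e) * \<beta>" using x y by (simp add: algebra_simps)
    then show "\<sigma> (x + y) = \<sigma> x + \<sigma> y"
      using \<sigma>[of "a + c" "b + e"] \<sigma>[of a b] \<sigma>[of c e] x y by (simp add: algebra_simps)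
    have xy: "x * y = (a * c + b * e * (\<beta> * \<beta>)) + (a * e + b * c) * \<beta>"
      using x y by (simp add: algebra_simps)
    have "a * c + b * e * (\<beta> * \<beta>) \<in> \<rat>"
      by (rule Rats_add[OF Rats_mult[OF x(1) y(1)] Rats_mult[OF Rats_mult[OF x(2) y(2)] \<beta>(3)]])
    moreover have "a * e + b * c \<in> \<rat>" using x y by simp
    ultimately have "\<sigma> (x * y) = (a * c + b * e * (\<beta> * \<beta>)) - (a * e + b * c) * \<beta>"
      unfolding xy by (rule \<sigma>)
    also have "\<dots> = (a - b * \<beta>) * (c - e * \<beta>)" by (simp add: algebra_simps)
    finally show "\<sigma> (x * y) = \<sigma> x * \<sigma> y" using \<sigma>[of a b] \<sigma>[of c e] x y by simp
  next
    show "\<sigma> 1 = 1" using \<sigma>[of 1 0] by simp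
  qed
  moreover have "bij_betw \<sigma> K K"
    by (rule bij_betw_byWitness[where f' = \<sigma>]) (auto simp: \<sigma>\<sigma> \<sigma>K)
  moreover have "\<sigma> \<beta> \<noteq> \<beta>" using \<sigma>[of 0 1] \<beta>(2) by auto
  ultimately show ?thesis unfolding ring_iso_def using \<beta>(1)
    by (intro exI[of _ \<sigma>]) (auto simp: \<sigma>_def)
qed

text \<open>Rationals are fixed, so \<open>\<beta>\<close> goes to a square root of
  \<open>\<beta> * \<beta>\<close>. The image \<open>\<beta>\<close> would give the identity, which
  leaves \<open>- \<beta>\<close>, and this determines the map.\<close>

lemma quad_conj_unique:
  assumes K: "real_quadratic_field K"
    and \<sigma>: "\<sigma> \<in> ring_iso (real_ring\<lparr>carrier := K\<rparr>) (real_ring\<lparr>carrier := K\<rparr>)"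
      "\<sigma> \<in> extensional K" "\<exists>x\<in>K. \<sigma> x \<noteq> x"
    and \<tau>: "\<tau> \<in> ring_iso (real_ring\<lparr>carrier := K\<rparr>) (real_ring\<lparr>carrier := K\<rparr>)"
      "\<tau> \<in> extensional K" "\<exists>x\<in>K. \<tau> x \<noteq> x"
  shows "\<sigma> = \<tau>"
proof -
  have sub: "subfield K real_ring" using K by (simp add: real_quadratic_field_def)
  note closed = subfield_real_closed[OF sub] and QK = subfield_rats[OF sub]
  obtain \<beta> where \<beta>: "\<beta> \<in> K" "\<beta> \<notin> \<rat>" "\<beta> * \<beta> \<in> \<rat>"
    using real_quadratic_field_sqrt_generator[OF K] .
  note coord = real_quadratic_field_coordinates[OF K \<beta>(1,2)]
  have conj: "\<rho> (a + b * \<beta>) = a - b * \<beta>"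
    if \<rho>: "\<rho> \<in> ring_iso (real_ring\<lparr>carrier := K\<rparr>) (real_ring\<lparr>carrier := K\<rparr>)"
      "\<exists>x\<in>K. \<rho> x \<noteq> x" and ab: "a \<in> \<rat>" "b \<in> \<rat>" for \<rho> a b
  proof -
    have hom: "\<rho> \<in> Ring.ring_hom (real_ring\<lparr>carrier := K\<rparr>) (real_ring\<lparr>carrier := K\<rparr>)"
      using \<rho>(1) by (simp add: ring_iso_def)
    have lin: "\<rho> (a + b * \<beta>) = a + b * \<rho> \<beta>" if ab: "a \<in> \<rat>" "b \<in> \<rat>" for a b
    proof -
      have "a \<in> K" "b \<in> K" using ab QK by auto
      then show ?thesis
        using ring_hom_add[OF hom, of a "b * \<beta>"] ring_hom_mult[OF hom, of b \<beta>] \<beta>(1) closed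
          subfield_hom_rat[OF sub hom] ab by simp
    qed
    have "\<rho> \<beta> * \<rho> \<beta> = \<beta> * \<beta>"
      using ring_hom_mult[OF hom, of \<beta> \<beta>] \<beta> subfield_hom_rat[OF sub hom] by simp
    then have "\<rho> \<beta> = \<beta> \<or> \<rho> \<beta> = - \<beta>" by (simp add: square_eq_iff)
    moreover have "\<rho> \<beta> \<noteq> \<beta>"
    proof
      assume "\<rho> \<beta> = \<beta>"
      then have "\<rho> x = x" if "x \<in> K" for x
        using lin by (auto intro: coord[OF that])
      then show False using \<rho>(2) by blast
    qed
    ultimately show ?thesis using lin[OF ab] by simp
  qed
  show ?thesis
  proof (rule extensionalityI[OF \<sigma>(2) \<tau>(2)])
    fix x assume x: "x \<in> K"
    obtain a b where "a \<in> \<rat>" "b \<in> \<rat>" "x = a + b * \<beta>" using coord[OF x] .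
    then show "\<sigma> x = \<tau> x" using conj[OF \<sigma>(1,3)] conj[OF \<tau>(1,3)] by simp
  qed
qed

lemma quad_conj:
  assumes K: "real_quadratic_field K"
  shows "quad_conj K \<in> ring_iso (real_ring\<lparr>carrier := K\<rparr>) (real_ring\<lparr>carrier := K\<rparr>)"
    and "\<exists>x\<in>K. quad_conj K x \<noteq> x"
proof -
  have "\<exists>!\<sigma>. \<sigma> \<in> ring_iso (real_ring\<lparr>carrier := K\<rparr>) (real_ring\<lparr>carrier := K\<rparr>) \<and>
             \<sigma> \<in> extensional K \<and> (\<exists>x\<in>K. \<sigma> x \<noteq> x)"
    using quad_conj_exists[OF K] quad_conj_unique[OF K] by (intro ex_ex1I) blast+
  from theI'[OF this]
  show "quad_conj K \<in> ring_iso (real_ring\<lparr>carrier := K\<rparr>) (real_ring\<lparr>carrier := K\<rparr>)"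
    and "\<exists>x\<in>K. quad_conj K x \<noteq> x"
    unfolding quad_conj_def by blast+
qed

text \<open>Norm 1 makes the conjugate of \<open>u\<close> its inverse, so the trace is fixed by
  conjugation. An irrational fixed element would generate \<open>K\<close> and make conjugation
  trivial; hence the trace is a rational algebraic integer.\<close>

lemma norm_one_unit_trace_int:
  assumes K: "real_quadratic_field K" and u: "u \<in> Units (int_ring K)" "quad_norm K u = 1"
  obtains t :: int where "u + inverse u = of_int t"
proof -
  have sub: "subfield K real_ring" using K by (simp add: real_quadratic_field_def)
  note closed = subfield_real_closed[OF sub]
  let ?\<sigma> = "quad_conj K"
  have hom: "?\<sigma> \<in> Ring.ring_hom (real_ring\<lparr>carrier := K\<rparr>) (real_ring\<lparr>carrier := K\<rparr>)"
    using quad_conj(1)[OF K] by (simp add: ring_iso_def)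
  obtain v where v: "v \<in> K" "algebraic_int v" "u * v = 1" and uK: "u \<in> K" "algebraic_int u"
    using u(1) unfolding Units_def by auto
  have vu: "v = inverse u" using v(3) by (metis inverse_unique)
  have su: "?\<sigma> u = v" using inverse_unique[of u "?\<sigma> u"] u(2) vu
    by (simp add: quad_norm_def)
  have "?\<sigma> u * ?\<sigma> v = 1"
    using ring_hom_mult[OF hom, of u v] ring_hom_one[OF hom] v uK by simp
  then have sv: "?\<sigma> v = u" using inverse_unique[of v "?\<sigma> v"] vu su by simp
  have fixed: "?\<sigma> (u + v) = u + v"
    using ring_hom_add[OF hom, of u v] v uK su sv by simp
  have "u + v \<in> \<rat>"
  proof (rule ccontr)
    assume irr: "u + v \<notin> \<rat>"
    have "?\<sigma> x = x" if x: "x \<in> K" for x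
    proof -
      obtain a b where ab: "a \<in> \<rat>" "b \<in> \<rat>" "x = a + b * (u + v)"
        using real_quadratic_field_coordinates[OF K closed(3)[OF uK(1) v(1)] irr x] .
      have "a \<in> K" "b \<in> K" using ab subfield_rats[OF sub] by auto
      then show ?thesis
        using ring_hom_add[OF hom, of a "b * (u + v)"] ring_hom_mult[OF hom, of b "u + v"]
          closed uK v fixed subfield_hom_rat[OF sub hom] ab by simp
    qed
    then show False using quad_conj(2)[OF K] by blast
  qed
  then have "u + v \<in> \<int>"
    using rational_algebraic_int_is_int algebraic_int_add[OF uK(2) v(2)] by blast
  then show ?thesis using that vu by (metis Ints_cases)
qed

subsection \<open>Traces of powers and symmetric geometric sums\<close>

text \<open>The Lucas sequence of the second kind with parameters \<open>t\<close> and 1; for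
  \<open>t = u + inverse u\<close> it gives the traces of the powers of \<open>u\<close>.\<close>

fun trace_seq :: "int \<Rightarrow> nat \<Rightarrow> int" where
  "trace_seq t 0 = 2"
| "trace_seq t (Suc 0) = t"
| "trace_seq t (Suc (Suc k)) = t * trace_seq t (Suc k) - trace_seq t k"

lemma trace_seq_eq:
  fixes u :: real
  assumes "u + inverse u = of_int t" "u \<noteq> 0"
  shows "u ^ k + inverse u ^ k = of_int (trace_seq t k)"
  using assms
proof (induction t k rule: trace_seq.induct)
  case (3 t k)
  have "(u + inverse u) * (u ^ Suc k + inverse u ^ Suc k) - (u ^ k + inverse u ^ k)
      = u ^ Suc (Suc k) + inverse u ^ Suc (Suc k) + (u * inverse u - 1) * (u ^ k + inverse u ^ k)"
    by (simp add: algebra_simps)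
  then show ?case using 3 by simp
qed auto

lemma even_trace_seq: "even t \<Longrightarrow> even (trace_seq t k)"
  by (induction t k rule: trace_seq.induct) auto

text \<open>Modulo 2 the recurrence is that of the Fibonacci numbers, so parities repeat as even,
  odd, odd. Two neighbouring terms carry the induction.\<close>

lemma odd_trace_seq_mod3:
  assumes "odd t"
  shows "even (trace_seq t (3 * k)) \<and> odd (trace_seq t (Suc (3 * k)))"
proof (induction k)
  case 0
  show ?case using assms by simp
next
  case (Suc k)
  have "3 * Suc k = Suc (Suc (Suc (3 * k)))" by simp
  then show ?case using Suc assms by (simp only: trace_seq.simps) simp
qed

lemma odd_trace_seq:
  assumes "odd t" "\<not> 3 dvd k"
  shows "odd (trace_seq t k)"
proof -
  have "k = Suc (3 * (k div 3)) \<or> k = Suc (Suc (3 * (k div 3)))" using assms(2) by presburger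
  moreover have "odd (trace_seq t (Suc (Suc (3 * (k div 3)))))"
    using odd_trace_seq_mod3[OF assms(1), of "k div 3"] assms(1) by simp
  ultimately show ?thesis using odd_trace_seq_mod3[OF assms(1), of "k div 3"] by metis
qed

lemma trace_seq_double:
  fixes u :: real
  assumes "u + inverse u = of_int t" "u \<noteq> 0"
  shows "trace_seq t (2 * k) = (trace_seq t k)\<^sup>2 - 2"
proof -
  have "u ^ k * inverse u ^ k = 1" using assms(2) by (simp add: power_mult_distrib[symmetric])
  then have "u ^ (2 * k) + inverse u ^ (2 * k) = (u ^ k + inverse u ^ k)\<^sup>2 - 2"
    unfolding mult_2 power_add by (simp add: power2_eq_square algebra_simps)
  then have "real_of_int (trace_seq t (2 * k)) = of_int ((trace_seq t k)\<^sup>2 - 2)"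
    using trace_seq_eq[OF assms] by simp
  then show ?thesis by linarith
qed

text \<open>By \<open>x\<^sup>2 - 2 + 1 = (x + 1) (x - 1)\<close> with \<open>x\<close> odd, each doubling of the index gains a
  factor of two.\<close>

lemma two_power_dvd_trace_seq:
  fixes u :: real
  assumes "u + inverse u = of_int t" "u \<noteq> 0" "odd t" "\<not> 3 dvd k"
  shows "2 ^ Suc n dvd trace_seq t (2 ^ n * k) + 1"
proof (induction n)
  case 0
  then show ?case using odd_trace_seq[OF assms(3,4)] by simp
next
  case (Suc n)
  let ?x = "trace_seq t (2 ^ n * k)"
  have "trace_seq t (2 ^ Suc n * k) + 1 = (?x + 1) * (?x - 1)"
    using trace_seq_double[OF assms(1,2), of "2 ^ n * k"]
    by (simp add: mult.assoc algebra_simps power2_eq_square)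
  moreover have "even (?x + 1)" using Suc by (meson dvd_trans dvd_power zero_less_Suc)
  then have "2 dvd ?x - 1" by simp
  then have "2 ^ Suc n * 2 dvd (?x + 1) * (?x - 1)" using Suc by (intro mult_dvd_mono)
  ultimately show ?case by (simp add: mult.commute)
qed

text \<open>This is \<open>G u m\<close> of the overview, written as a shifted geometric sum so that
  all exponents are natural numbers.\<close>

definition sym_geom :: "real \<Rightarrow> nat \<Rightarrow> real" where
  "sym_geom u m = (\<Sum>i<2 * m + 1. u ^ i) / u ^ m"

text \<open>The powers are grouped into \<open>2 * s + 1\<close> blocks of length
  \<open>2 * c + 1\<close>; the shifts agree since \<open>m = c + (2 * c + 1) * s\<close>.\<close>

lemma sym_geom_times:
  assumes "(2 * c + 1) * (2 * s + 1) = 2 * m + (1::nat)"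
  shows "sym_geom u m = sym_geom u c * sym_geom (u ^ (2 * c + 1)) s"
proof -
  have m: "m = c + (2 * c + 1) * s" using assms by (simp add: algebra_simps)
  have split: "(\<Sum>i<a + b. u ^ i) = (\<Sum>i<a. u ^ i) + u ^ a * (\<Sum>i<b. u ^ i)" for a b
    by (induction b) (simp_all add: algebra_simps power_add)
  have "(\<Sum>i<w * n. u ^ i) = (\<Sum>i<w. u ^ i) * (\<Sum>i<n. (u ^ w) ^ i)" for w n
  proof (induction n)
    case (Suc n)
    then show ?case using split[of "w * n" w] by (simp add: algebra_simps flip: power_mult)
  qed simp
  from this[of "2 * c + 1" "2 * s + 1"] show ?thesis
    unfolding sym_geom_def assms[symmetric] m
    by (simp only: power_add power_mult) simp
qed

lemma sym_geom_Suc: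
  assumes "u \<noteq> 0"
  shows "sym_geom u (Suc m) = sym_geom u m + (u ^ Suc m + inverse u ^ Suc m)"
proof -
  have "(\<Sum>i<2 * Suc m + 1. u ^ i) = 1 + u * (\<Sum>i<2 * m + 1. u ^ i) + u ^ (2 * m + 2)"
  proof -
    have "2 * Suc m + 1 = Suc (Suc (2 * m + 1))" by simp
    then have "(\<Sum>i<2 * Suc m + 1. u ^ i) = 1 + (\<Sum>i<Suc (2 * m + 1). u * u ^ i)"
      by (simp only: sum.lessThan_Suc_shift[of _ "Suc (2 * m + 1)"] power_0 power_Suc)
    then show ?thesis by (simp only: sum.lessThan_Suc[of _ "2 * m + 1"] sum_distrib_left) simp
  qed
  then show ?thesis using assms unfolding sym_geom_def
    by (simp add: field_simps power_add mult_2_right del: sum.lessThan_Suc)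
qed

text \<open>Each increase of \<open>m\<close> adds the two outermost powers, which together form a
  trace.\<close>

lemma sym_geom_power_int:
  assumes "u + inverse u = of_int t" "u \<noteq> 0"
  shows "sym_geom (u ^ j) m = of_int (1 + (\<Sum>i=1..m. trace_seq t (j * i)))"
proof (induction m)
  case 0
  show ?case by (simp add: sym_geom_def)
next
  case (Suc m)
  have "(u ^ j) ^ Suc m + inverse (u ^ j) ^ Suc m = of_int (trace_seq t (j * Suc m))"
    using trace_seq_eq[OF assms, of "j * Suc m"]
    by (simp add: power_mult power_inverse del: mult_Suc_right power_Suc)
  then show ?case using Suc sym_geom_Suc[of "u ^ j" m] assms(2) by simp
qed

lemma d_seq_eq:
  assumes "\<Delta> \<noteq> 0" "u > 1" "j > 0"
  shows "d_seq \<Delta> u j m = sym_geom (u ^ j) m"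
proof -
  define q where "q = u ^ j"
  have q: "q > 1" using assms by (simp add: q_def)
  have f: "f_seq \<Delta> u (j * n) = (q ^ n - inverse q ^ n) / sqrt (of_int \<Delta>)" for n
    unfolding f_seq_def q_def power_int_minus power_int_of_nat power_inverse power_mult ..
  \<comment> \<open>This covers negative \<open>\<Delta>\<close> as well, where \<open>sqrt\<close>
    takes a negative value; the root then cancels in the quotient.\<close>
  have "sqrt (of_int \<Delta>) \<noteq> 0" using assms by simp
  then have r: "r_seq \<Delta> u j n = (q ^ n - inverse q ^ n) / (q - inverse q)" for n
    using f[of n] f[of 1] by (simp add: r_seq_def)
  have qq: "q - inverse q = (q - 1) * (1 + inverse q)" using q by (simp add: field_simps)
  have "(\<Sum>i<2 * m + 1. q ^ i) = (q ^ (2 * m + 1) - 1) / (q - 1)"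
    using q geometric_sum[of q "2 * m + 1"] by simp
  then have "sym_geom q m = (q ^ (2 * m + 1) - 1) / q ^ m / (q - 1)" by (simp add: sym_geom_def)
  also have "(q ^ (2 * m + 1) - 1) / q ^ m = q ^ Suc m - inverse q ^ m"
    using q by (simp add: field_simps power_add mult_2_right)
  \<comment> \<open>Expanding the fraction by \<open>1 + inverse q\<close> produces the denominator
    of \<open>r_seq\<close>, and its numerator splits into those for \<open>m + 1\<close> and
    \<open>m\<close>.\<close>
  also have "(q ^ Suc m - inverse q ^ m) / (q - 1) =
    ((q ^ Suc m - inverse q ^ m) * (1 + inverse q)) / (q - inverse q)"
    unfolding qq using q by (simp add: add_pos_pos less_imp_neq[symmetric])
  also have "(q ^ Suc m - inverse q ^ m) * (1 + inverse q) =
    (q ^ (m + 1) - inverse q ^ (m + 1)) + (q ^ m - inverse q ^ m)"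
    using q by (simp add: algebra_simps)
  finally show ?thesis unfolding d_seq_def r q_def[symmetric] by (simp add: add_divide_distrib)
qed

section \<open>Congruences modulo \<open>d\<close> among algebraic integers\<close>

lemma power_eq_one_mod:
  fixes x :: "'a::field_char_0"
  assumes "algebraic_int x"
  shows "\<exists>y. algebraic_int y \<and> (1 + of_nat d * x) ^ n = 1 + of_nat d * y"
proof (induction n)
  case 0
  then show ?case by (intro exI[of _ 0]) auto
next
  case (Suc n)
  then obtain y where y: "algebraic_int y" "(1 + of_nat d * x) ^ n = 1 + of_nat d * y" by blast
  \<comment> \<open>The witness comes from expanding
    \<open>(1 + d * x) * (1 + d * y)\<close>.\<close>
  have "algebraic_int (x + y + of_nat d * (x * y))"
    by (intro algebraic_int_add algebraic_int_mult assms y(1) int_imp_algebraic_int[OF Ints_of_nat])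
  moreover have "(1 + of_nat d * x) ^ Suc n = 1 + of_nat d * (x + y + of_nat d * (x * y))"
    unfolding power_Suc y(2) by (simp add: algebra_simps)
  ultimately show ?case by blast
qed

text \<open>Each of the \<open>2 s + 1\<close> summands is congruent to \<open>1\<close> modulo \<open>d\<close>, and \<open>u\<close> is a unit.\<close>

lemma sym_geom_divisible:
  assumes x: "algebraic_int x" and u: "u = 1 + of_nat d * x" "algebraic_int (inverse u)"
    and e: "e dvd d" "e dvd 2 * s + 1"
  obtains y where "algebraic_int y" "sym_geom u s = of_nat e * y"
proof -
  obtain f where f: "\<And>i. algebraic_int (f i)" "\<And>i. u ^ i = 1 + of_nat d * f i"
    using power_eq_one_mod[OF x, of d] unfolding u(1) by metis
  obtain k where k: "d = e * k" using e(1) by blast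
  obtain l where l: "2 * s + 1 = e * l" using e(2) by blast
  let ?F = "\<Sum>i<2 * s + 1. f i"
  have "(\<Sum>i<2 * s + 1. u ^ i) = (\<Sum>i<2 * s + 1. 1 + of_nat d * f i)" by (simp only: f(2))
  also have "\<dots> = of_nat (2 * s + 1) + of_nat d * ?F"
    by (simp only: sum.distrib sum_distrib_left sum_constant card_lessThan mult_1_right)
  also have "\<dots> = of_nat e * (of_nat l + of_nat k * ?F)"
    unfolding l k by (simp add: algebra_simps)
  finally have "sym_geom u s = of_nat e * ((of_nat l + of_nat k * ?F) * inverse u ^ s)"
    by (simp add: sym_geom_def divide_inverse power_inverse)
  moreover have "algebraic_int ((of_nat l + of_nat k * ?F) * inverse u ^ s)"
    by (intro algebraic_int_add algebraic_int_mult algebraic_int_power algebraic_int_sum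
        f(1) u(2) int_imp_algebraic_int[OF Ints_of_nat])
  ultimately show ?thesis using that by blast
qed

section \<open>Transfer to integer divisibility and assembly of the theorem\<close>

lemma int_dvd_of_int: "int_dvd n (of_int M) \<longleftrightarrow> int n dvd M"
proof -
  have "real_of_int M = of_nat n * of_int k \<longleftrightarrow> M = int n * k" for k
    by (metis of_int_eq_iff of_int_mult of_int_of_nat_eq)
  then show ?thesis by (auto simp: int_dvd_def)
qed

lemma int_odd_of_int: "int_odd (of_int M) \<longleftrightarrow> odd M"
proof -
  have "real_of_int M = 2 * of_int k + 1 \<longleftrightarrow> M = 2 * k + 1" for k by linarith
  then show ?thesis unfolding int_odd_def by presburger
qed

theorem theorem6p13:
  fixes K :: "real set" and \<Delta>\<^sub>0 :: int and \<epsilon> :: real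
    and d r l1 l2 a b l j m :: nat
  assumes "real_quadratic_field K"
    and "has_discriminant K \<Delta>\<^sub>0"
    and "smallest_norm_one_unit K \<epsilon>"
    and "d > 0"
    and "r = ord_mod K d \<epsilon>"
    and "d = 2 ^ l1 * (2 * a + 1)"
    and "r = 2 ^ l2 * (2 * b + 1)"
    and "l = max l1 l2"
    and "j > 0" and "m > 0"
    and "2 ^ l dvd j"
    and "(2 * a + 1) * (2 * b + 1) dvd 2 * m + 1"
    and "even d \<Longrightarrow> coprime j 3 \<and> 3 dvd 2 * m + 1"
  shows "(int_dvd 2 (d_seq \<Delta>\<^sub>0 \<epsilon> 1 1) \<longrightarrow> int_dvd d (d_seq \<Delta>\<^sub>0 \<epsilon> j m)) \<and>
         (int_odd (d_seq \<Delta>\<^sub>0 \<epsilon> 1 1) \<longrightarrow> (int_dvd d (d_seq \<Delta>\<^sub>0 \<epsilon> j m) \<longleftrightarrow> odd d))"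
proof (cases "\<Delta>\<^sub>0 = 0")
  case True
  \<comment> \<open>Division by zero gives zero, so every term of the sequence vanishes.\<close>
  then have "d_seq \<Delta>\<^sub>0 \<epsilon> i n = of_int 0" for i n
    by (simp add: d_seq_def r_seq_def f_seq_def)
  then show ?thesis by (simp only: int_dvd_of_int int_odd_of_int) simp
next
  case False
  note K = assms(1)
  have sub: "subfield K real_ring" using K by (simp add: real_quadratic_field_def)
  have unit: "\<epsilon> \<in> Units (int_ring K)" "quad_norm K \<epsilon> = 1" and "\<epsilon> > 1"
    using assms(3) by (auto simp: smallest_norm_one_unit_def Let_def)
  then have \<epsilon>0: "\<epsilon> \<noteq> 0" by simp
  obtain t where t: "\<epsilon> + inverse \<epsilon> = of_int t" using norm_one_unit_trace_int[OF K unit] .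
  have inv: "algebraic_int (inverse \<epsilon>)"
  proof -
    obtain v where "algebraic_int v" "\<epsilon> * v = 1" using unit(1) unfolding Units_def by auto
    then show ?thesis using inverse_unique[of \<epsilon> v] by simp
  qed
  \<comment> \<open>Hence \<open>d_seq\<close> at \<open>1 1\<close> is even exactly when the trace
    \<open>t\<close> is odd.\<close>
  have d1: "d_seq \<Delta>\<^sub>0 \<epsilon> 1 1 = of_int (1 + t)"
    using d_seq_eq[OF False \<open>\<epsilon> > 1\<close>, of 1 1] sym_geom_power_int[OF t \<epsilon>0, of 1 1] by simp
  define N where "N = 1 + (\<Sum>i=1..m. trace_seq t (j * i))"
  have geom: "sym_geom (\<epsilon> ^ j) m = of_int N"
    using sym_geom_power_int[OF t \<epsilon>0] by (simp add: N_def)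
  then have dN: "d_seq \<Delta>\<^sub>0 \<epsilon> j m = of_int N" using d_seq_eq[OF False \<open>\<epsilon> > 1\<close> \<open>j > 0\<close>] by simp
  have odd_part: "int (2 * a + 1) dvd N"
  proof -
    obtain x where x: "algebraic_int x" "\<epsilon> ^ r = 1 + of_nat d * x"
      using unit_pow_ord_mod[OF sub unit(1), of d] unfolding assms(5) .
    \<comment> \<open>The two-part of \<open>r\<close> divides \<open>j\<close> and its odd part is
      \<open>2 * b + 1\<close>, so \<open>(\<epsilon> ^ j) ^ (2 * b + 1)\<close> is a power of
      \<open>\<epsilon> ^ r\<close>.\<close>
    have "2 ^ l2 dvd j" using assms(8,11) by (metis dvd_trans le_imp_power_dvd max.cobounded2)
    then have "r dvd j * (2 * b + 1)" unfolding assms(7) by (intro mult_dvd_mono) auto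
    then obtain c where c: "j * (2 * b + 1) = r * c" by blast
    obtain y where y: "algebraic_int y" "(\<epsilon> ^ j) ^ (2 * b + 1) = 1 + of_nat d * y"
      using power_eq_one_mod[OF x(1), of d c] unfolding x(2)[symmetric] power_mult[symmetric] c
      by blast
    \<comment> \<open>The cofactor of \<open>2 * b + 1\<close> in \<open>2 * m + 1\<close> is odd,
      which yields \<open>s\<close>, and it is a multiple of \<open>2 * a + 1\<close>.\<close>
    obtain e where e: "2 * m + 1 = (2 * a + 1) * (2 * b + 1) * e" using assms(12) by blast
    have "odd (2 * m + 1)" by simp
    then have "odd ((2 * a + 1) * e)" unfolding e by simp
    then obtain s where s: "(2 * a + 1) * e = 2 * s + 1" by (elim oddE)
    have m: "(2 * b + 1) * (2 * s + 1) = 2 * m + 1" unfolding e s[symmetric] by (simp only: mult_ac)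
    have "algebraic_int (inverse ((\<epsilon> ^ j) ^ (2 * b + 1)))"
      using inv algebraic_int_power by (metis power_inverse)
    moreover have "2 * a + 1 dvd d" unfolding assms(6) by (rule dvd_triv_right)
    moreover have "2 * a + 1 dvd 2 * s + 1" unfolding s[symmetric] by (rule dvd_triv_left)
    ultimately obtain z where z: "algebraic_int z"
      "sym_geom ((\<epsilon> ^ j) ^ (2 * b + 1)) s = of_nat (2 * a + 1) * z"
      by (rule sym_geom_divisible[OF y])
    define M where "M = 1 + (\<Sum>i=1..b. trace_seq t (j * i))"
    have "of_int N = of_int M * (of_nat (2 * a + 1) * z)"
      using sym_geom_times[OF m] sym_geom_power_int[OF t \<epsilon>0, of j b] geom z(2) M_def by simp
    then have N: "of_int N = of_nat (2 * a + 1) * (of_int M * z)" by simp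
    then have "of_int M * z = of_int N / of_nat (2 * a + 1)" by (simp add: field_simps)
    then have "of_int M * z \<in> \<rat>" by simp
    moreover have "algebraic_int (of_int M * z)"
      by (intro algebraic_int_mult z(1) int_imp_algebraic_int Ints_of_int)
    ultimately have "of_int M * z \<in> \<int>" by (rule rational_algebraic_int_is_int[rotated])
    then obtain k where "of_int M * z = of_int k" by (elim Ints_cases)
    then have "int_dvd (2 * a + 1) (of_int N)" unfolding int_dvd_def N by auto
    then show ?thesis by (simp only: int_dvd_of_int)
  qed

  have two_part: "2 ^ l1 dvd N" if "even d" "odd t"
  proof -
    have "coprime j 3" "3 dvd 2 * m + 1" using assms(13) that by auto
    have "2 ^ l1 dvd j" using assms(8,11) by (metis dvd_trans le_imp_power_dvd max.cobounded1)
    then obtain k where k: "j = 2 ^ l1 * k" by blast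
    \<comment> \<open>The cofactor \<open>k\<close> inherits this from \<open>j\<close>, as the
      parity pattern of the traces requires.\<close>
    have "\<not> 3 dvd j" using \<open>coprime j 3\<close> by (auto simp: coprime_commute coprime_absorb_left)
    then have "\<not> 3 dvd k" unfolding k by auto
    then have "2 ^ Suc l1 dvd trace_seq t j + 1"
      unfolding k by (rule two_power_dvd_trace_seq[OF t \<epsilon>0 \<open>odd t\<close>])
    then have dvd: "2 ^ l1 dvd trace_seq t j + 1" by (metis dvd_mult_right power_Suc)
    obtain w where w: "2 * m + 1 = 3 * w" using \<open>3 dvd 2 * m + 1\<close> by blast
    have "odd (2 * m + 1)" by simp
    then have "odd w" unfolding w by simp
    then obtain s where "w = 2 * s + 1" by (elim oddE)
    \<comment> \<open>Blocks of length 3, that is \<open>c = 1\<close>, split off the factor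
      \<open>1 + trace_seq t j\<close>.\<close>
    then have m: "(2 * 1 + 1) * (2 * s + 1) = 2 * m + 1" using w by simp
    have "sym_geom (\<epsilon> ^ j) m = sym_geom (\<epsilon> ^ j) 1 * sym_geom (\<epsilon> ^ (j * 3)) s"
      using sym_geom_times[OF m, of "\<epsilon> ^ j"] by (simp add: power_mult)
    also have "\<dots> = of_int ((trace_seq t j + 1) * (1 + (\<Sum>i=1..s. trace_seq t (j * 3 * i))))"
      by (simp only: sym_geom_power_int[OF t \<epsilon>0]) simp
    finally have "N = (trace_seq t j + 1) * (1 + (\<Sum>i=1..s. trace_seq t (j * 3 * i)))"
      unfolding geom by (simp only: of_int_eq_iff)
    then show ?thesis using dvd by simp
  qed

  have odd_d: "int d dvd N" if "odd d"
  proof -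
    have "l1 = 0" using that assms(6) by (cases l1) auto
    then show ?thesis using odd_part assms(6) by simp
  qed
  have even_d: "int d dvd N" if "even d" "odd t"
  proof -
    have "coprime (2 ^ l1) (int (2 * a + 1))" by simp
    then have "2 ^ l1 * int (2 * a + 1) dvd N"
      using two_part[OF that] odd_part by (intro divides_mult)
    moreover have "int d = 2 ^ l1 * int (2 * a + 1)"
      unfolding assms(6) by (simp add: algebra_simps)
    ultimately show ?thesis by (simp only:)
  qed
  have odd_N: "odd N" if "even t"
    using that by (auto simp: N_def intro!: dvd_sum even_trace_seq)
  have not_dvd: "\<not> int d dvd N" if "even d" "even t"
    using odd_N[OF that(2)] that(1) by (meson dvd_trans even_of_nat)
  \<comment> \<open>Case (1) is odd \<open>t\<close>, settled by \<open>odd_d\<close> and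
    \<open>even_d\<close>; case (2) is even \<open>t\<close>, settled by \<open>odd_d\<close> and
    \<open>not_dvd\<close>.\<close>
  have "int_dvd 2 (of_int (1 + t)) \<longleftrightarrow> odd t" by (simp only: int_dvd_of_int) simp
  moreover have "int_odd (of_int (1 + t)) \<longleftrightarrow> even t" by (simp only: int_odd_of_int) simp
  ultimately show ?thesis
    unfolding dN d1 int_dvd_of_int using odd_d even_d not_dvd by blast
qed

end
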